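(* Let $d\in\mathbb N$, $\mathcal D=\{1,\dots,d\}$, $U\subseteq\mathcal P(\mathcal D)$ a subset of ANOVA terms and $w:\mathbb Z^d\to[1,\infty)$ a weight function. If $f\in\mathcal A^w(\mathbb T^d)$, then $$\frac{\|f-\mathrm T_Uf\|_{\mathrm L_\infty(\mathbb T^d)}}{\|f\|_{\mathcal A^w(\mathbb T^d)}}\le\frac{1}{\min_{\mathbf k\in\bigcup_{\mathbf u\subseteq\mathcal D,\,\mathbf u\notin U}\mathbb F^{(d)}_{\mathbf u}}w(\mathbf k)}.$$ If $f\in\mathrm H^w(\mathbb T^d)$ and $\{1/w(\mathbf k)\}_{\mathbf k\in\mathbb Z^d}\in\ell_2$, then $$\|f-\mathrm T_Uf\|_{\mathrm L_\infty(\mathbb T^d)}\le\sqrt{\sum_{\mathbf k\in\bigcup_{\mathbf u\subseteq\mathcal D,\,\mathbf u\notin U}\mathbb F^{(d)}_{\mathbf u}}\frac{1}{w(\mathbf k)^2}}\ \|f\|_{\mathrm H^w(\mathbb T^d)}.$$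
   Context: $\mathbb T=[0,1)$ with periodic identification; $c_{\mathbf k}(g)=\int_{\mathbb T^d} g(\mathbf x)e^{-2\pi i\mathbf k\cdot\mathbf x}\,d\mathbf x$. $\mathrm H^w(\mathbb T^d)=\{g\in\mathrm L_2:\|g\|_{\mathrm H^w}=(\sum_{\mathbf k}w(\mathbf k)^2|c_{\mathbf k}(g)|^2)^{1/2}<\infty\}$; $\mathcal A^w(\mathbb T^d)=\{g\in\mathrm L_1:\|g\|_{\mathcal A^w}=\sum_{\mathbf k}w(\mathbf k)|c_{\mathbf k}(g)|<\infty\}$. For $\mathbf u\subseteq\mathcal D$: $\mathbf u^c=\mathcal D\setminus\mathbf u$, $\mathrm P_{\mathbf u}f(\mathbf x_{\mathbf u})=\int_{\mathbb T^{|\mathbf u^c|}}f(\mathbf x)\,d\mathbf x_{\mathbf u^c}$, ANOVA terms $f_{\mathbf u}=\mathrm P_{\mathbf u}f-\sum_{\mathbf v\subsetneq\mathbf u}f_{\mathbf v}$ (recursively), $\mathbb F^{(d)}_{\mathbf u}=\{\mathbf k\in\mathbb Z^d:\mathbf k_{\mathbf u^c}=\mathbf 0,\ k_j\neq0\ \forall j\in\mathbf u\}$. A subset of ANOVA terms is $U\subseteq\mathcal P(\mathcal D)$ closed under taking subsets; $\mathrm T_Uf=\sum_{\mathbf u\in U}f_{\mathbf u}$. *)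

theory Defs
  imports "HOL-Analysis.Analysis" "HOL-Probability.Probability"
begin

definition T1 :: "real measure" where
  "T1 = restrict_space lborel {0..<1}"

(* The d-dimensional torus, d = CARD('n), coordinates indexed by the finite type 'n. *)
definition torus :: "('n::finite \<Rightarrow> real) measure" where
  "torus = PiM UNIV (\<lambda>_. T1)"

definition kdot :: "('n::finite \<Rightarrow> int) \<Rightarrow> ('n \<Rightarrow> real) \<Rightarrow> real" where
  "kdot k x = (\<Sum>i\<in>UNIV. real_of_int (k i) * x i)"

definition fcoeff :: "('n::finite \<Rightarrow> int) \<Rightarrow> (('n \<Rightarrow> real) \<Rightarrow> complex) \<Rightarrow> complex" where
  "fcoeff k g = (LINT x|torus. g x * exp (- 2 * pi * \<i> * complex_of_real (kdot k x)))"

definition L2 :: "(('n::finite \<Rightarrow> real) \<Rightarrow> complex) set" where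
  "L2 = {g. g \<in> borel_measurable torus \<and> integrable torus (\<lambda>x. (cmod (g x))\<^sup>2)}"

definition L1 :: "(('n::finite \<Rightarrow> real) \<Rightarrow> complex) set" where
  "L1 = {g. integrable torus g}"

definition Hw_norm :: "(('n::finite \<Rightarrow> int) \<Rightarrow> real) \<Rightarrow> (('n \<Rightarrow> real) \<Rightarrow> complex) \<Rightarrow> real" where
  "Hw_norm w g = sqrt (\<Sum>\<^sub>\<infinity>k. (w k)\<^sup>2 * (cmod (fcoeff k g))\<^sup>2)"

definition Hw :: "(('n::finite \<Rightarrow> int) \<Rightarrow> real) \<Rightarrow> (('n \<Rightarrow> real) \<Rightarrow> complex) set" where
  "Hw w = {g \<in> L2. (\<lambda>k. (w k)\<^sup>2 * (cmod (fcoeff k g))\<^sup>2) summable_on UNIV}"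

definition Aw_norm :: "(('n::finite \<Rightarrow> int) \<Rightarrow> real) \<Rightarrow> (('n \<Rightarrow> real) \<Rightarrow> complex) \<Rightarrow> real" where
  "Aw_norm w g = (\<Sum>\<^sub>\<infinity>k. w k * cmod (fcoeff k g))"

definition Aw :: "(('n::finite \<Rightarrow> int) \<Rightarrow> real) \<Rightarrow> (('n \<Rightarrow> real) \<Rightarrow> complex) set" where
  "Aw w = {g \<in> L1. (\<lambda>k. w k * cmod (fcoeff k g)) summable_on UNIV}"

definition Linf_norm :: "(('n::finite \<Rightarrow> real) \<Rightarrow> complex) \<Rightarrow> ennreal" where
  "Linf_norm g = esssup torus (\<lambda>x. ennreal (cmod (g x)))"

definition Pproj :: "'n::finite set \<Rightarrow> (('n \<Rightarrow> real) \<Rightarrow> complex) \<Rightarrow> ('n \<Rightarrow> real) \<Rightarrow> complex" where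
  "Pproj u f x = (LINT y|PiM (- u) (\<lambda>_. T1). f (\<lambda>i. if i \<in> u then x i else y i))"

function anova :: "(('n::finite \<Rightarrow> real) \<Rightarrow> complex) \<Rightarrow> 'n set \<Rightarrow> ('n \<Rightarrow> real) \<Rightarrow> complex" where
  "anova f u x = Pproj u f x - (\<Sum>v\<in>{v. v \<subset> u}. anova f v x)"
  by auto
termination
  by (relation "Wellfounded.measure (\<lambda>(f, u, x). card u)") (auto intro: psubset_card_mono)

definition anova_subset :: "'n::finite set set \<Rightarrow> bool" where
  "anova_subset U \<longleftrightarrow> (\<forall>u\<in>U. \<forall>v. v \<subseteq> u \<longrightarrow> v \<in> U)"

definition TU :: "'n::finite set set \<Rightarrow> (('n \<Rightarrow> real) \<Rightarrow> complex) \<Rightarrow> ('n \<Rightarrow> real) \<Rightarrow> complex" where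
  "TU U f x = (\<Sum>u\<in>U. anova f u x)"

definition Freq :: "'n::finite set \<Rightarrow> ('n \<Rightarrow> int) set" where
  "Freq u = {k. (\<forall>j. j \<notin> u \<longrightarrow> k j = 0) \<and> (\<forall>j\<in>u. k j \<noteq> 0)}"

definition Fcompl :: "'n::finite set set \<Rightarrow> ('n \<Rightarrow> int) set" where
  "Fcompl U = (\<Union>u\<in>{u. u \<notin> U}. Freq u)"

end

theory Submission
  imports Defs
begin

text \<open>
  The ANOVA term \<open>f\<^sub>u\<close> has Fourier coefficients \<open>c\<^sub>k(f)\<close> for \<open>k\<close> with support \<open>u\<close> and \<open>0\<close> otherwise, so
  \<open>f - T\<^sub>U f\<close> keeps exactly the coefficients of \<open>f\<close> whose support is not in \<open>U\<close>. An integrable function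
  with absolutely summable coefficients agrees almost everywhere with its Fourier series, whence
  \<open>f - T\<^sub>U f\<close> is bounded by the sum of the remaining \<open>\<bar>c\<^sub>k(f)\<bar>\<close>; both estimates are then Hoelder
  inequalities for this sum. The agreement rests on uniqueness of Fourier coefficients in \<open>L\<^sub>1\<close>: the
  bounded functions that map the integrable functions without Fourier coefficients to themselves
  contain \<open>cos (2 \<pi> x\<^sub>i)\<close> and \<open>sin (2 \<pi> x\<^sub>i)\<close>, hence by Weierstrass approximation and dominated
  convergence all measurable indicators.
\<close>

section \<open>Characters of the torus\<close>

text \<open>The Fourier kernel with its minus sign, over an index set \<open>J\<close> so that it
  factors when the coordinates are split into \<open>u\<close> and \<open>- u\<close>. Negating
  \<open>k\<close> gives the conjugate.\<close>

definition character :: "'n set \<Rightarrow> ('n \<Rightarrow> int) \<Rightarrow> ('n \<Rightarrow> real) \<Rightarrow> complex" where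
  "character J k x = (\<Prod>i\<in>J. cis (- (2 * pi * (of_int (k i) * x i))))"

lemma prob_space_T1: "prob_space T1"
proof
  show "emeasure T1 (space T1) = 1"
    by (simp add: T1_def space_restrict_space emeasure_restrict_space)
qed

lemma space_T1: "space T1 = {0..<1}"
  by (simp add: T1_def space_restrict_space)

lemma borel_measurable_T1: "f \<in> borel_measurable borel \<Longrightarrow> f \<in> borel_measurable T1"
  by (simp add: T1_def measurable_restrict_space1)

lemma product_sigma_finite_T1: "product_sigma_finite (\<lambda>_. T1)"
  unfolding product_sigma_finite_def using prob_space_T1 by (auto intro: prob_space_imp_sigma_finite)

lemma prob_space_torus: "prob_space torus"
  unfolding torus_def by (intro prob_space_PiM prob_space_T1)

lemma real_component_PiM [measurable (raw)]: "i \<in> J \<Longrightarrow> (\<lambda>x. x i) \<in> borel_measurable (PiM J (\<lambda>_. T1))"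
  by (rule measurable_compose[OF measurable_component_singleton[of i J "\<lambda>_. T1"] borel_measurable_T1]) auto

lemma real_component_torus [measurable (raw)]: "(\<lambda>x. x i) \<in> borel_measurable torus"
  unfolding torus_def by simp

lemma space_torus: "x \<in> space torus \<longleftrightarrow> (\<forall>i. 0 \<le> x i \<and> x i < 1)"
  by (auto simp: torus_def space_PiM space_T1 PiE_iff)

text \<open>For \<open>m\<close> nonzero the antiderivative has period 1, so its values at 0 and 1
  cancel.\<close>

lemma integral_T1_cis: "(LINT x|T1. cis (- (2 * pi * (of_int m * x)))) = (if m = 0 then 1 else 0)"
proof (cases "m = 0")
  case True
  then show ?thesis by (simp add: prob_space.prob_space[OF prob_space_T1])
next
  case False
  define c where "c = - 2 * pi * of_int m"
  have c: "c \<noteq> 0" using False by (simp add: c_def)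
  have c1: "cis c = 1"
    using cis_multiple_2pi[of "- real_of_int m"] by (simp add: c_def mult_ac)
  have "(LINT x|T1. cis (c * x)) = (LINT x|lborel. indicator {0..<1} x *\<^sub>R cis (c * x))"
    by (simp add: T1_def integral_restrict_space)
  \<comment> \<open>Adding the null point 1 gives the closed interval on which the fundamental
    theorem of calculus is applied.\<close>
  also have "\<dots> = (LINT x|lborel. indicator {0..1} x *\<^sub>R cis (c * x))"
  proof (rule integral_cong_AE)
    have "AE x in lborel. x \<noteq> (1::real)" by (rule AE_lborel_singleton)
    then show "AE x in lborel. indicator {0..<1::real} x *\<^sub>R cis (c * x) = indicator {0..1} x *\<^sub>R cis (c * x)"
      by eventually_elim (auto simp: indicator_def)
  qed (auto simp: cis_conv_exp)
  also have "\<dots> = cis (c * 1) / (\<i> * c) - cis (c * 0) / (\<i> * c)"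
  proof (rule integral_FTC_atLeastAtMost)
    fix x :: real
    have "((\<lambda>z. exp (\<i> * c * z) / (\<i> * c)) has_field_derivative exp (\<i> * c * of_real x)) (at (of_real x))"
      using c by (auto intro!: derivative_eq_intros)
    then have "((\<lambda>x. exp (\<i> * c * of_real x) / (\<i> * c)) has_vector_derivative exp (\<i> * c * of_real x)) (at x within {0..1})"
      by (rule has_vector_derivative_real_field)
    then show "((\<lambda>x. cis (c * x) / (\<i> * c)) has_vector_derivative cis (c * x)) (at x within {0..1})"
      by (simp add: cis_conv_exp mult_ac)
  qed (auto simp: cis_conv_exp intro!: continuous_intros)
  finally show ?thesis using False c1 by (simp add: c_def mult_ac)
qed

lemma norm_character [simp]: "norm (character J k x) = 1"
  by (simp add: character_def prod_norm[symmetric])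

lemma character_measurable [measurable]: "J \<subseteq> I \<Longrightarrow> character J k \<in> borel_measurable (PiM I (\<lambda>_. T1))"
  unfolding character_def[abs_def] cis_conv_exp
  by (intro borel_measurable_prod borel_measurable_exp borel_measurable_times borel_measurable_uminus
      borel_measurable_of_real borel_measurable_const real_component_PiM) auto

lemma character_measurable_torus [measurable]: "character J k \<in> borel_measurable torus"
  unfolding torus_def by simp

lemma integral_character:
  assumes "finite J"
  shows "(LINT x|PiM J (\<lambda>_. T1). character J k x) = (if \<forall>i\<in>J. k i = 0 then 1 else 0)"
proof -
  have int: "integrable T1 (\<lambda>x. cis (- (2 * pi * (of_int m * x))))" for m
  proof (rule finite_measure.integrable_const_bound[OF prob_space.finite_measure[OF prob_space_T1], where B=1])
    show "(\<lambda>x. cis (- (2 * pi * (of_int m * x)))) \<in> borel_measurable T1"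
      unfolding cis_conv_exp by (rule borel_measurable_T1) measurable
  qed simp
  show ?thesis
    unfolding character_def product_sigma_finite.product_integral_prod[OF product_sigma_finite_T1 assms int] integral_T1_cis
    using assms by (auto simp: prod_zero_iff)
qed

lemma fcoeff_character: "fcoeff k g = (LINT x|torus. g x * character UNIV k x)"
proof -
  have *: "exp (- 2 * pi * \<i> * complex_of_real (kdot k x)) = character UNIV k x" for x
    unfolding character_def kdot_def cis_conv_exp exp_sum[OF finite, symmetric]
    by (simp add: sum_distrib_left mult_ac sum_negf)
  show ?thesis unfolding fcoeff_def * ..
qed

lemma integrable_character:
  assumes "integrable torus g"
  shows "integrable torus (\<lambda>x. g x * character UNIV k x)"
  by (rule Bochner_Integration.integrable_bound[OF assms]) (use assms in \<open>auto simp: norm_mult\<close>)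

text \<open>This is what makes trigonometric functions multipliers: an exponential in one coordinate
  only shifts the frequency.\<close>

lemma character_shift:
  fixes k :: "'n::finite \<Rightarrow> int"
  shows "character UNIV (k(i := k i + m)) x = cis (- (2 * pi * (of_int m * x i))) * character UNIV k x"
proof -
  have "(\<Prod>j\<in>UNIV - {i}. cis (- (2 * pi * (of_int ((k(i := k i + m)) j) * x j)))) =
      (\<Prod>j\<in>UNIV - {i}. cis (- (2 * pi * (of_int (k j) * x j))))"
    by (intro prod.cong) auto
  moreover have "cis (- (2 * pi * (of_int (k i + m) * x i))) =
      cis (- (2 * pi * (of_int m * x i))) * cis (- (2 * pi * (of_int (k i) * x i)))"
    unfolding cis_mult by (rule arg_cong[of _ _ cis]) (simp add: algebra_simps)
  ultimately show ?thesis
    unfolding character_def prod.remove[OF finite UNIV_I[of i]] by simp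
qed

lemma character_mult: "character J k x * character J l x = character J (\<lambda>i. k i + l i) x"
  by (simp add: character_def prod.distrib[symmetric] cis_mult algebra_simps)

section \<open>Uniqueness of Fourier coefficients\<close>

text \<open>Asking that multiplication by \<open>F\<close> preserve vanishing of \<^emph>\<open>all\<close> coefficients (not merely that
  one integral vanish) makes this set an algebra closed under bounded pointwise limits.\<close>

definition multiplier :: "(('n::finite \<Rightarrow> real) \<Rightarrow> real) set" where
  "multiplier = {F \<in> borel_measurable torus. (\<exists>C. \<forall>x\<in>space torus. \<bar>F x\<bar> \<le> C) \<and>
     (\<forall>h. integrable torus h \<longrightarrow> (\<forall>k. fcoeff k h = 0) \<longrightarrow>
       (\<forall>k. fcoeff k (\<lambda>x. complex_of_real (F x) * h x) = 0))}"

lemma multiplierI: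
  assumes "F \<in> borel_measurable torus" "\<And>x. x \<in> space torus \<Longrightarrow> \<bar>F x\<bar> \<le> C"
    and "\<And>h k. integrable torus h \<Longrightarrow> (\<And>k. fcoeff k h = 0) \<Longrightarrow> fcoeff k (\<lambda>x. complex_of_real (F x) * h x) = 0"
  shows "F \<in> multiplier"
  using assms unfolding multiplier_def by blast

lemma multiplier_measurable: "F \<in> multiplier \<Longrightarrow> F \<in> borel_measurable torus"
  unfolding multiplier_def by blast

lemma multiplier_bounded:
  assumes "F \<in> multiplier"
  obtains C where "C > 0" "\<And>x. x \<in> space torus \<Longrightarrow> \<bar>F x\<bar> \<le> C"
proof -
  obtain C where "\<forall>x\<in>space torus. \<bar>F x\<bar> \<le> C"
    using assms unfolding multiplier_def by blast
  \<comment> \<open>The maximum with 1 makes the bound positive;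
    \<open>multiplier_indicator_greater\<close> divides by it.\<close>
  then show ?thesis by (intro that[of "max C 1"]) fastforce+
qed

lemma multiplier_fcoeff:
  "F \<in> multiplier \<Longrightarrow> integrable torus h \<Longrightarrow> (\<And>k. fcoeff k h = 0) \<Longrightarrow> fcoeff k (\<lambda>x. complex_of_real (F x) * h x) = 0"
  unfolding multiplier_def by blast

lemma multiplier_integrable:
  assumes "F \<in> multiplier" "integrable torus h"
  shows "integrable torus (\<lambda>x. complex_of_real (F x) * h x)"
proof -
  obtain C where C: "C > 0" "\<And>x. x \<in> space torus \<Longrightarrow> \<bar>F x\<bar> \<le> C"
    using multiplier_bounded[OF assms(1)] by blast
  note [measurable] = multiplier_measurable[OF assms(1)] borel_measurable_integrable[OF assms(2)]
  show ?thesis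
  proof (rule Bochner_Integration.integrable_bound)
    show "integrable torus (\<lambda>x. C *\<^sub>R h x)" using assms by simp
    show "AE x in torus. norm (complex_of_real (F x) * h x) \<le> norm (C *\<^sub>R h x)"
      using C by (intro AE_I2) (simp add: norm_mult mult_right_mono)
  qed measurable
qed

section \<open>Closure properties of the multipliers\<close>

lemma fcoeff_cmult: "fcoeff k (\<lambda>x. c * h x) = c * fcoeff k h"
  unfolding fcoeff_character mult.assoc by simp

lemma multiplier_const: "(\<lambda>_. c) \<in> multiplier"
  by (rule multiplierI[of _ "\<bar>c\<bar>"]) (simp_all add: fcoeff_cmult)

lemma multiplier_add:
  assumes F: "F \<in> multiplier" and G: "G \<in> multiplier"
  shows "(\<lambda>x. F x + G x) \<in> multiplier"
proof -
  obtain C D where C: "\<And>x. x \<in> space torus \<Longrightarrow> \<bar>F x\<bar> \<le> C" "\<And>x. x \<in> space torus \<Longrightarrow> \<bar>G x\<bar> \<le> D"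
    using multiplier_bounded[OF F] multiplier_bounded[OF G] by metis
  show ?thesis
  proof (rule multiplierI)
    show "(\<lambda>x. F x + G x) \<in> borel_measurable torus"
      using assms by (intro borel_measurable_add multiplier_measurable)
    show "\<bar>F x + G x\<bar> \<le> C + D" if "x \<in> space torus" for x
      using C[OF that] by linarith
    show "fcoeff k (\<lambda>x. complex_of_real (F x + G x) * h x) = 0"
      if h: "integrable torus h" "\<And>k. fcoeff k h = 0" for h k
      using integrable_character[OF multiplier_integrable[OF F h(1)], of k] integrable_character[OF multiplier_integrable[OF G h(1)], of k]
        multiplier_fcoeff[OF F h, of k] multiplier_fcoeff[OF G h, of k]
      by (simp add: fcoeff_character distrib_right)
  qed
qed

lemma multiplier_mult:
  assumes F: "F \<in> multiplier" and G: "G \<in> multiplier"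
  shows "(\<lambda>x. F x * G x) \<in> multiplier"
proof -
  obtain C D where C: "\<And>x. x \<in> space torus \<Longrightarrow> \<bar>F x\<bar> \<le> C" "\<And>x. x \<in> space torus \<Longrightarrow> \<bar>G x\<bar> \<le> D"
    using multiplier_bounded[OF F] multiplier_bounded[OF G] by metis
  show ?thesis
  proof (rule multiplierI)
    show "(\<lambda>x. F x * G x) \<in> borel_measurable torus"
      using assms by (intro borel_measurable_times multiplier_measurable)
    show "\<bar>F x * G x\<bar> \<le> C * D" if "x \<in> space torus" for x
      unfolding abs_mult using C[OF that] by (intro mult_mono) auto
    show "fcoeff k (\<lambda>x. complex_of_real (F x * G x) * h x) = 0"
      if h: "integrable torus h" "\<And>k. fcoeff k h = 0" for h k
      \<comment> \<open>\<open>G * h\<close> is again integrable with no Fourier coefficients, so it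
        serves as the test function for \<open>F\<close>.\<close>
      using multiplier_fcoeff[OF F multiplier_integrable[OF G h(1)] multiplier_fcoeff[OF G h]]
      by (simp add: mult.assoc)
  qed
qed

lemma multiplier_sum:
  assumes "\<And>i. i \<in> I \<Longrightarrow> F i \<in> multiplier"
  shows "(\<lambda>x. \<Sum>i\<in>I. F i x) \<in> multiplier"
  using assms by (induction I rule: infinite_finite_induct) (auto intro: multiplier_const multiplier_add)

lemma multiplier_power: "F \<in> multiplier \<Longrightarrow> (\<lambda>x. F x ^ n) \<in> multiplier"
  by (induction n) (auto intro: multiplier_const multiplier_mult)

lemma multiplier_diff:
  assumes "F \<in> multiplier" "G \<in> multiplier"
  shows "(\<lambda>x. F x - G x) \<in> multiplier"
  using multiplier_add[OF assms(1) multiplier_mult[OF multiplier_const assms(2)], of "-1"] by simp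

text \<open>Dominated convergence with majorant \<open>C * norm (h x)\<close>: each coefficient of
  the limit is a limit of zeros. The bound \<open>C\<close> is uniform in \<open>n\<close> for this
  purpose.\<close>

lemma multiplier_limit:
  fixes F :: "nat \<Rightarrow> ('n::finite \<Rightarrow> real) \<Rightarrow> real"
  assumes F: "\<And>n. F n \<in> multiplier" and C: "\<And>n x. x \<in> space torus \<Longrightarrow> \<bar>F n x\<bar> \<le> C"
    and lim: "\<And>x. x \<in> space torus \<Longrightarrow> (\<lambda>n. F n x) \<longlonglongrightarrow> G x"
  shows "G \<in> multiplier"
proof -
  note [measurable] = multiplier_measurable[OF F]
  have G[measurable]: "G \<in> borel_measurable torus"
    by (rule borel_measurable_LIMSEQ_metric[OF _ lim]) (rule multiplier_measurable[OF F])
  show ?thesis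
  proof (rule multiplierI[OF G])
    show "\<bar>G x\<bar> \<le> C" if "x \<in> space torus" for x
      by (rule LIMSEQ_le_const2[OF tendsto_rabs[OF lim[OF that]]]) (use C that in blast)
    fix h :: "('n \<Rightarrow> real) \<Rightarrow> complex" and k assume h: "integrable torus h" "\<And>k. fcoeff k h = 0"
    note [measurable] = borel_measurable_integrable[OF h(1)]
    have "(\<lambda>n. LINT x|torus. complex_of_real (F n x) * h x * character UNIV k x)
       \<longlonglongrightarrow> (LINT x|torus. complex_of_real (G x) * h x * character UNIV k x)"
    proof (rule integral_dominated_convergence)
      show "integrable torus (\<lambda>x. C * norm (h x))" using h(1) by simp
      show "AE x in torus. (\<lambda>n. complex_of_real (F n x) * h x * character UNIV k x)
          \<longlonglongrightarrow> complex_of_real (G x) * h x * character UNIV k x"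
        by (intro AE_I2 tendsto_intros lim)
      show "AE x in torus. norm (complex_of_real (F n x) * h x * character UNIV k x) \<le> C * norm (h x)" for n
        by (intro AE_I2) (simp add: norm_mult mult_right_mono C)
    qed measurable
    then show "fcoeff k (\<lambda>x. complex_of_real (G x) * h x) = 0"
      using multiplier_fcoeff[OF F h] by (simp add: fcoeff_character LIMSEQ_const_iff)
  qed
qed

lemma multiplier_trig:
  fixes i :: "'n::finite"
  shows multiplier_cos: "(\<lambda>x. cos (2 * pi * x i)) \<in> multiplier"
    and multiplier_sin: "(\<lambda>x. sin (2 * pi * x i)) \<in> multiplier"
proof -
  let ?c = "\<lambda>m x. cis (- (2 * pi * (of_int m * x i)))"
  have int: "integrable torus (\<lambda>x. ?c m x * (h x * character UNIV k x))"
    if "integrable torus h" for h m k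
  proof (rule Bochner_Integration.integrable_bound[OF integrable_character[OF that, of k]])
    note [measurable] = borel_measurable_integrable[OF that]
    show "(\<lambda>x. ?c m x * (h x * character UNIV k x)) \<in> borel_measurable torus"
      unfolding cis_conv_exp by measurable
  qed (simp add: norm_mult)
  \<comment> \<open>The factor \<open>?c m\<close> turns the coefficient at \<open>k\<close> into
    the one at \<open>k(i := k i + m)\<close>, which also vanishes.\<close>
  have z: "(LINT x|torus. ?c m x * (h x * character UNIV k x)) = 0"
    if "\<And>k. fcoeff k h = 0" for h m k
    using that[of "k(i := k i + m)"]
    by (simp add: fcoeff_character character_shift mult_ac)
  have comb: "fcoeff k (\<lambda>x. (a * ?c (-1) x + b * ?c 1 x) * h x) = 0"
    if h: "integrable torus h" "\<And>k. fcoeff k h = 0" for a b h k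
  proof -
    have "fcoeff k (\<lambda>x. (a * ?c (-1) x + b * ?c 1 x) * h x) =
      (LINT x|torus. a * (?c (-1) x * (h x * character UNIV k x)) + b * (?c 1 x * (h x * character UNIV k x)))"
      unfolding fcoeff_character distrib_right mult.assoc ..
    also have "\<dots> = a * (LINT x|torus. ?c (-1) x * (h x * character UNIV k x)) + b * (LINT x|torus. ?c 1 x * (h x * character UNIV k x))"
      unfolding integral_mult_right_zero[symmetric]
      by (intro Bochner_Integration.integral_add integrable_mult_right int h)
    finally show ?thesis unfolding z[OF h(2)] by simp
  qed
  \<comment> \<open>Euler's formulas. As \<open>?c m\<close> contains a minus sign,
    \<open>?c (-1)\<close> is the exponential with positive exponent, which fixes the signs in the
    sine.\<close>
  have c: "complex_of_real (cos (2 * pi * x i)) = 1/2 * ?c (-1) x + 1/2 * ?c 1 x" for x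
    by (simp add: complex_eq_iff)
  have s: "complex_of_real (sin (2 * pi * x i)) = - \<i>/2 * ?c (-1) x + \<i>/2 * ?c 1 x" for x
    by (simp add: complex_eq_iff)
  show "(\<lambda>x. cos (2 * pi * x i)) \<in> multiplier"
  proof (rule multiplierI)
    show "(\<lambda>x. cos (2 * pi * x i)) \<in> borel_measurable torus"
      by (rule borel_measurable_continuous_on[of "\<lambda>t. cos (2 * pi * t)"])
        (auto intro!: continuous_intros real_component_torus)
    show "\<bar>cos (2 * pi * x i)\<bar> \<le> 1" for x by simp
  qed (unfold c, rule comb)
  show "(\<lambda>x. sin (2 * pi * x i)) \<in> multiplier"
  proof (rule multiplierI)
    show "(\<lambda>x. sin (2 * pi * x i)) \<in> borel_measurable torus"
      by (rule borel_measurable_continuous_on[of "\<lambda>t. sin (2 * pi * t)"])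
        (auto intro!: continuous_intros real_component_torus)
    show "\<bar>sin (2 * pi * x i)\<bar> \<le> 1" for x by simp
  qed (unfold s, rule comb)
qed

text \<open>Bernstein polynomials in \<open>F\<close> are multipliers by the algebra rules, and they
  approximate \<open>G\<close> uniformly on the unit interval.\<close>

lemma multiplier_continuous:
  assumes F: "F \<in> multiplier" and F01: "\<And>x. x \<in> space torus \<Longrightarrow> F x \<in> {0..1}"
    and G: "continuous_on {0..1} G"
  shows "(\<lambda>x. G (F x)) \<in> multiplier"
proof -
  have "\<exists>P\<in>multiplier. \<forall>x\<in>space torus. \<bar>G (F x) - P x\<bar> < 1 / Suc m" for m
  proof -
    obtain N where "\<forall>n x. N \<le> n \<and> x \<in> {0..1} \<longrightarrow> \<bar>G x - (\<Sum>k\<le>n. G (k/n) * Bernstein n k x)\<bar> < 1 / Suc m"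
      using Bernstein_Weierstrass[OF G, of "1 / Suc m"] by auto
    then have "\<forall>x\<in>space torus. \<bar>G (F x) - (\<Sum>k\<le>N. G (k/N) * Bernstein N k (F x))\<bar> < 1 / Suc m"
      using F01 by blast
    moreover have "(\<lambda>x. \<Sum>k\<le>N. G (k/N) * Bernstein N k (F x)) \<in> multiplier"
      unfolding Bernstein_def
      by (intro multiplier_sum multiplier_mult multiplier_const multiplier_power multiplier_diff F)
    ultimately show ?thesis by (intro bexI)
  qed
  then obtain P where P: "\<And>m. P m \<in> multiplier" "\<And>m x. x\<in>space torus \<Longrightarrow> \<bar>G (F x) - P m x\<bar> < 1 / Suc m"
    by metis
  have "bounded (G ` {0..1})"
    using G by (intro compact_imp_bounded compact_continuous_image) auto
  then obtain B where B: "\<And>t. t \<in> {0..1} \<Longrightarrow> \<bar>G t\<bar> \<le> B"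
    unfolding bounded_iff by (metis imageI real_norm_def)
  show ?thesis
  \<comment> \<open>\<open>B\<close> bounds \<open>G\<close>, and each approximant is within
    \<open>1 / Suc n\<close>, at most 1, of \<open>G (F x)\<close>.\<close>
  proof (rule multiplier_limit[of P "B + 1"])
    fix n :: nat and x :: "'a \<Rightarrow> real" assume x: "x \<in> space torus"
    have "\<bar>G (F x) - P n x\<bar> < 1 / Suc n" using P x by auto
    also have "\<dots> \<le> 1" by simp
    finally show "\<bar>P n x\<bar> \<le> B + 1" using B[OF F01[OF x]] by linarith
  next
    fix x :: "'a \<Rightarrow> real" assume x: "x \<in> space torus"
    have "(\<lambda>m. P m x - G (F x)) \<longlonglongrightarrow> 0"
    proof (rule Lim_null_comparison)
      show "\<forall>\<^sub>F m in sequentially. norm (P m x - G (F x)) \<le> 1 / Suc m"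
        using P(2)[OF x] by (intro always_eventually) (auto simp: abs_minus_commute less_imp_le)
      show "(\<lambda>m. 1 / real (Suc m)) \<longlonglongrightarrow> 0"
        using LIMSEQ_inverse_real_of_nat by (simp add: inverse_eq_divide)
    qed
    then show "(\<lambda>m. P m x) \<longlonglongrightarrow> G (F x)" by (simp add: LIM_zero_iff)
  qed (rule P)
qed

text \<open>The indicator of a superlevel set is a pointwise limit of continuous ramps in
  \<open>F\<close>.\<close>

lemma multiplier_indicator_greater:
  assumes F: "F \<in> multiplier"
  shows "indicator {x \<in> space torus. a < F x} \<in> multiplier"
proof -
  obtain C where C: "C > 0" "\<And>x. x \<in> space torus \<Longrightarrow> \<bar>F x\<bar> \<le> C"
    using multiplier_bounded[OF F] by blast
  \<comment> \<open>Affine rescaling of \<open>F\<close> from \<open>[-C, C]\<close> to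
    \<open>[0, 1]\<close>, where continuous functions may be applied; \<open>b\<close> below is the
    image of the threshold \<open>a\<close>.\<close>
  define t where "t = (\<lambda>x. (F x + C) * (1 / (2 * C)))"
  have t: "t \<in> multiplier" unfolding t_def by (intro multiplier_mult multiplier_add multiplier_const F)
  have t01: "t x \<in> {0..1}" if "x \<in> space torus" for x
    using C(1) C(2)[OF that] by (auto simp: t_def field_simps abs_le_iff)
  define b where "b = (a + C) * (1 / (2 * C))"
  have tb: "b < t x \<longleftrightarrow> a < F x" for x
    using C(1) by (simp add: t_def b_def divide_less_cancel)
  \<comment> \<open>The ramp is 0 up to \<open>b\<close>, then rises with slope \<open>n\<close>
    until it is cut off at 1.\<close>
  define G where "G = (\<lambda>n s. min 1 (max 0 (real n * (s - b))))"
  show ?thesis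
  proof (rule multiplier_limit[of "\<lambda>n x. G n (t x)" 1])
    show "(\<lambda>x. G n (t x)) \<in> multiplier" for n
      by (rule multiplier_continuous[OF t t01]) (auto simp: G_def intro!: continuous_intros)
    show "\<bar>G n (t x)\<bar> \<le> 1" for n x by (auto simp: G_def)
    fix x :: "'a \<Rightarrow> real" assume x: "x \<in> space torus"
    show "(\<lambda>n. G n (t x)) \<longlonglongrightarrow> indicator {x \<in> space torus. a < F x} x"
    proof (cases "b < t x")
      case True
      \<comment> \<open>From this \<open>N\<close> on the ramp has reached its ceiling at
        \<open>t x\<close>.\<close>
      obtain N :: nat where N: "1 < real N * (t x - b)"
        using True ex_less_of_nat_mult[of "t x - b" 1] by auto
      have "\<forall>\<^sub>F n in sequentially. G n (t x) = 1"
        using eventually_ge_at_top[of N]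
      proof eventually_elim
        case (elim n)
        then have "real N * (t x - b) \<le> real n * (t x - b)" using True by (intro mult_right_mono) auto
        then show ?case using N by (auto simp: G_def)
      qed
      then show ?thesis using True tb x by (auto intro: tendsto_eventually)
    next
      case False
      have "G n (t x) = 0" for n
        using False by (simp add: G_def mult_nonneg_nonpos)
      then show ?thesis using False tb by auto
    qed
  qed
qed

text \<open>Intersections are products of indicators, complements are differences from 1, and
  countable unions are bounded limits of finite unions.\<close>

lemma sigma_algebra_multiplier:
  "sigma_algebra (space torus) {A \<in> sets torus. indicator A \<in> multiplier}" (is "sigma_algebra _ ?S")
  unfolding sigma_algebra_iff2
proof (intro conjI ballI allI impI)
  show "?S \<subseteq> Pow (space torus)" using sets.sets_into_space by blast
  show empty: "{} \<in> ?S" using multiplier_const[of 0] by (simp add: indicator_def[abs_def])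
  have int: "A \<inter> B \<in> ?S" if "A \<in> ?S" "B \<in> ?S" for A B
    using that multiplier_mult[of "indicator A" "indicator B"] by (auto simp: indicator_inter_arith[abs_def])
  show compl: "space torus - A \<in> ?S" if "A \<in> ?S" for A
  proof -
    have "(\<lambda>x. 1 - indicator A x) \<in> multiplier"
      using that by (intro multiplier_diff multiplier_const) simp
    \<comment> \<open>Outside \<open>space torus\<close> the two functions differ, but the limit
      rule, used with a constant sequence, compares them only on the space.\<close>
    then have "indicator (space torus - A) \<in> multiplier"
      by (rule multiplier_limit[of "\<lambda>_ x. 1 - indicator A x" 1]) (auto simp: indicator_def)
    then show ?thesis using that by auto
  qed
  fix A :: "nat \<Rightarrow> ('a \<Rightarrow> real) set" assume A: "range A \<subseteq> ?S"
  have UN: "(\<Union>i<n. A i) \<in> ?S" for n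
  proof (induction n)
    case 0 then show ?case using empty by simp
  next
    case (Suc n)
    have An: "A n \<in> ?S" using A by blast
    \<comment> \<open>De Morgan: the finite union is built from complements and an
      intersection.\<close>
    then have "space torus - ((space torus - (\<Union>i<n. A i)) \<inter> (space torus - A n)) \<in> ?S"
      using Suc by (intro compl int)
    also have "space torus - ((space torus - (\<Union>i<n. A i)) \<inter> (space torus - A n)) = (\<Union>i<n. A i) \<union> A n"
      using Suc An sets.sets_into_space[of "A n" torus] sets.sets_into_space[of "\<Union>i<n. A i" torus] by blast
    also have "\<dots> = (\<Union>i<Suc n. A i)" by (auto simp: lessThan_Suc)
    finally show ?case .
  qed
  have "indicator (\<Union>i. A i) \<in> multiplier"
  proof (rule multiplier_limit[of "\<lambda>n. indicator (\<Union>i<n. A i)" 1])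
    show "indicator (\<Union>i<n. A i) \<in> multiplier" for n using UN by blast
  qed (rule indicator_abs_le_1 LIMSEQ_indicator_UN)+
  moreover have "(\<Union>i. A i) \<in> sets torus" using A by blast
  ultimately show "(\<Union>i. A i) \<in> ?S" by blast
qed

text \<open>Recovers a coordinate as a Borel function of its cosine and sine, so the
  \<open>\<sigma>\<close>-algebra above contains every measurable set of the torus.\<close>

lemma arccos_cos_circle:
  assumes "0 \<le> t" "t < 1"
  shows "t = (if 0 \<le> sin (2 * pi * t) then arccos (cos (2 * pi * t)) / (2 * pi)
       else 1 - arccos (cos (2 * pi * t)) / (2 * pi))"
proof (cases "t \<le> 1/2")
  case True
  then have "0 \<le> sin (2 * pi * t)" using assms by (intro sin_ge_zero) auto
  then show ?thesis using True assms by (simp add: arccos_cos)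
next
  case False
  \<comment> \<open>Reflecting \<open>t\<close> to \<open>1 - t\<close> keeps the cosine, flips the
    sine, and moves the angle into the range where \<open>arccos\<close> inverts
    \<open>cos\<close>.\<close>
  have "sin (2 * pi * t) = - sin (2 * pi * (1 - t))"
    by (simp add: right_diff_distrib sin_diff)
  moreover have "0 < sin (2 * pi * (1 - t))"
    using assms False by (intro sin_gt_zero) auto
  moreover have "cos (2 * pi * t) = cos (2 * pi * (1 - t))"
    by (simp add: right_diff_distrib cos_diff)
  moreover have "arccos (cos (2 * pi * (1 - t))) = 2 * pi * (1 - t)"
    using assms False by (intro arccos_cos) auto
  ultimately show ?thesis by simp
qed

text \<open>Multipliers are measurable for the sigma-algebra \<open>N\<close> of good sets.
  Coordinates are Borel functions of their cosine and sine, hence \<open>N\<close>-measurable too,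
  and they generate the sets of the torus.\<close>

lemma indicator_multiplier:
  fixes A :: "('n::finite \<Rightarrow> real) set"
  assumes "A \<in> sets torus"
  shows "indicator A \<in> multiplier"
proof -
  define N where "N = sigma (space torus) {A \<in> sets (torus :: ('n \<Rightarrow> real) measure). indicator A \<in> multiplier}"
  have sp: "space N = space torus"
    unfolding N_def by (rule space_measure_of) (use sets.sets_into_space in blast)
  have st: "sets N = {A \<in> sets torus. indicator A \<in> multiplier}"
    unfolding N_def by (rule sigma_algebra.sets_measure_of_eq[OF sigma_algebra_multiplier])
  have meas: "F \<in> borel_measurable N" if F: "F \<in> multiplier" for F
    unfolding borel_measurable_iff_greater sp st
    using multiplier_indicator_greater[OF F] multiplier_measurable[OF F]
    by (simp add: borel_measurable_iff_greater)
  have x: "(\<lambda>x. x i) \<in> N \<rightarrow>\<^sub>M T1" for i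
    unfolding T1_def
  proof (rule measurable_restrict_space2)
    show "(\<lambda>x. x i) \<in> space N \<rightarrow> {0..<1}" by (auto simp: sp space_torus)
    have sin[measurable]: "(\<lambda>x. sin (2 * pi * x i)) \<in> borel_measurable N"
      by (rule meas[OF multiplier_sin])
    \<comment> \<open>Clamping the argument to \<open>[-1, 1]\<close> gives continuity on the whole
      line and changes nothing at values of the cosine.\<close>
    have "continuous_on UNIV (\<lambda>t. arccos (max (-1) (min 1 t)))"
      by (intro continuous_intros) auto
    from borel_measurable_continuous_on[OF this meas[OF multiplier_cos]]
    have [measurable]: "(\<lambda>x. arccos (cos (2 * pi * x i))) \<in> borel_measurable N"
      by simp
    have "(\<lambda>x. if 0 \<le> sin (2 * pi * x i) then arccos (cos (2 * pi * x i)) / (2 * pi)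
       else 1 - arccos (cos (2 * pi * x i)) / (2 * pi)) \<in> borel_measurable N"
      by measurable
    then have "(\<lambda>x. x i) \<in> borel_measurable N"
    proof (rule measurable_cong[THEN iffD2, rotated])
      fix x assume "x \<in> space N"
      then show "x i = (if 0 \<le> sin (2 * pi * x i) then arccos (cos (2 * pi * x i)) / (2 * pi)
         else 1 - arccos (cos (2 * pi * x i)) / (2 * pi))"
        by (intro arccos_cos_circle) (auto simp: sp space_torus)
    qed
    then show "(\<lambda>x. x i) \<in> N \<rightarrow>\<^sub>M lborel" by simp
  qed
  \<comment> \<open>Measurability of the identity says that every measurable set of the torus
    belongs to \<open>N\<close>.\<close>
  have "(\<lambda>x. x) \<in> N \<rightarrow>\<^sub>M torus"
    unfolding torus_def
    by (rule measurable_PiM_single'[of UNIV "\<lambda>i x. x i"]) (use x in \<open>auto simp: sp torus_def space_PiM\<close>)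
  from measurable_sets[OF this assms] have "A \<in> sets N"
    using sets.sets_into_space[OF assms] by (simp add: sp Int_absorb2)
  then show ?thesis by (simp add: st)
qed

text \<open>Multiplying by an indicator keeps all coefficients zero, so \<open>h\<close> integrates
  to 0 over every measurable set; real and imaginary parts then vanish almost everywhere.\<close>

lemma fcoeff_unique:
  assumes h: "integrable torus h" and 0: "\<And>k. fcoeff k h = 0"
  shows "AE x in torus. h x = 0"
proof -
  have int: "integrable torus (\<lambda>x. indicator A x *\<^sub>R h x)" if "A \<in> sets torus" for A
    using integrable_mult_indicator[OF that h] .
  have z: "(LINT x|torus. indicator A x *\<^sub>R h x) = 0" if "A \<in> sets torus" for A
    \<comment> \<open>The coefficient at frequency 0 is the plain integral.\<close>
    using multiplier_fcoeff[OF indicator_multiplier[OF that] h 0, of "\<lambda>_. 0"]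
    by (simp add: fcoeff_character character_def scaleR_conv_of_real)
  have "AE x in torus. Re (h x) = 0"
  proof (rule density_unique_real)
    fix A :: "('a \<Rightarrow> real) set" assume A: "A \<in> sets torus"
    show "(LINT x:A|torus. Re (h x)) = (LINT x:A|torus. 0)"
      using z[OF A] integral_Re[OF int[OF A]] by (simp add: set_lebesgue_integral_def)
  qed (use h in auto)
  moreover have "AE x in torus. Im (h x) = 0"
  proof (rule density_unique_real)
    fix A :: "('a \<Rightarrow> real) set" assume A: "A \<in> sets torus"
    show "(LINT x:A|torus. Im (h x)) = (LINT x:A|torus. 0)"
      using z[OF A] integral_Im[OF int[OF A]] by (simp add: set_lebesgue_integral_def)
  qed (use h in auto)
  ultimately show ?thesis by eventually_elim (simp add: complex_eq_iff)
qed

section \<open>Absolutely convergent Fourier series\<close>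

lemma integral_torus_character: "(LINT x|torus. character UNIV k x) = (if \<forall>i. k i = 0 then 1 else 0)"
  unfolding torus_def using integral_character[of UNIV k] by simp

lemma fcoeff_diff:
  assumes "integrable torus g" "integrable torus h"
  shows "fcoeff k (\<lambda>x. g x - h x) = fcoeff k g - fcoeff k h"
  using integrable_character[OF assms(1), of k] integrable_character[OF assms(2), of k]
  by (simp add: fcoeff_character left_diff_distrib)

lemma fcoeff_sum:
  assumes "\<And>i. i \<in> I \<Longrightarrow> integrable torus (g i)"
  shows "fcoeff k (\<lambda>x. \<Sum>i\<in>I. g i x) = (\<Sum>i\<in>I. fcoeff k (g i))"
  unfolding fcoeff_character sum_distrib_right
  by (rule Bochner_Integration.integral_sum) (rule integrable_character[OF assms])

text \<open>The Fourier series \<open>S\<close> of \<open>g\<close> converges absolutely and has the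
  coefficients of \<open>g\<close>, so by uniqueness it equals \<open>g\<close> almost everywhere;
  the triangle inequality gives the bound.\<close>

lemma AE_norm_le_infsum_fcoeff:
  fixes g :: "('n::finite \<Rightarrow> real) \<Rightarrow> complex"
  assumes g: "integrable torus g" and sum: "(\<lambda>k. cmod (fcoeff k g)) summable_on UNIV"
  shows "AE x in torus. cmod (g x) \<le> (\<Sum>\<^sub>\<infinity>k. cmod (fcoeff k g))"
proof -
  interpret prob_space "torus :: ('n \<Rightarrow> real) measure" by (rule prob_space_torus)
  \<comment> \<open>Frequencies are enumerated by naturals to use theorems on ordinary series; the
    dimension is at least 1 because types are nonempty.\<close>
  have "infinite (UNIV :: ('n \<Rightarrow> int) set)"
    using finite_fun_UNIVD2 infinite_UNIV_int by blast
  then obtain b :: "nat \<Rightarrow> 'n \<Rightarrow> int" where b: "bij b"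
    using bij_betw_from_nat_into[of "UNIV :: ('n \<Rightarrow> int) set"] by blast
  \<comment> \<open>The negated frequency undoes the minus sign in \<open>character\<close>.\<close>
  define s where "s j x = fcoeff (b j) g * character UNIV (\<lambda>i. - b j i) x" for j x
  define S where "S x = (\<Sum>j. s j x)" for x
  have norm_s: "norm (s j x) = cmod (fcoeff (b j) g)" for j x
    by (simp add: s_def norm_mult)
  have sum_b: "summable (\<lambda>j. cmod (fcoeff (b j) g))"
    using sum summable_on_reindex_bij_betw[OF b, of "\<lambda>k. cmod (fcoeff k g)"]
    by (intro summable_on_imp_summable) simp
  have suminf_b: "(\<Sum>j. cmod (fcoeff (b j) g)) = (\<Sum>\<^sub>\<infinity>k. cmod (fcoeff k g))"
    unfolding infsum_reindex_bij_betw[OF b, of "\<lambda>k. cmod (fcoeff k g)", symmetric]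
    using sum_b by (intro infsumI[symmetric] norm_summable_imp_has_sum) (auto intro: summable_sums)
  have int_s: "integrable torus (s j)" for j
    by (rule integrable_const_bound[of _ "cmod (fcoeff (b j) g)"]) (simp_all add: norm_s, simp add: s_def[abs_def])
  have summable_s: "summable (\<lambda>j. norm (s j x))" for x
    using sum_b by (simp add: norm_s)
  have int_S: "integrable torus S"
    unfolding S_def[abs_def] using int_s summable_s sum_b
    by (intro integrable_suminf) (simp_all add: norm_s prob_space)
  have fcoeff_S: "fcoeff l S = fcoeff l g" for l
  proof -
    obtain j0 where j0: "b j0 = l" using b by (metis bij_pointE)
    have eq: "S x * character UNIV l x = (\<Sum>j. s j x * character UNIV l x)" for x
      unfolding S_def by (rule suminf_mult2[OF summable_norm_cancel[OF summable_s]])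
    \<comment> \<open>Absolute summability, uniform in \<open>x\<close>, allows integration term by
      term; by orthogonality only \<open>j0\<close> then contributes.\<close>
    have "fcoeff l S = (\<Sum>j. LINT x|torus. s j x * character UNIV l x)"
      unfolding fcoeff_character eq using int_s summable_s sum_b
      by (intro integral_suminf integrable_character) (simp_all add: norm_mult norm_s prob_space)
    also have "\<dots> = (\<Sum>j. if j = j0 then fcoeff l g else 0)"
    proof (intro suminf_cong)
      fix j
      have "(LINT x|torus. s j x * character UNIV l x) = fcoeff (b j) g * (LINT x|torus. character UNIV (\<lambda>i. - b j i + l i) x)"
        by (simp add: s_def mult.assoc character_mult)
      also have "(\<forall>i. - b j i + l i = 0) \<longleftrightarrow> j = j0"
        using bij_is_inj[OF b] j0 by (auto simp: inj_def fun_eq_iff)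
      then have "fcoeff (b j) g * (LINT x|torus. character UNIV (\<lambda>i. - b j i + l i) x) = (if j = j0 then fcoeff l g else 0)"
        using j0 by (simp add: integral_torus_character)
      finally show "(LINT x|torus. s j x * character UNIV l x) = (if j = j0 then fcoeff l g else 0)" .
    qed
    also have "\<dots> = fcoeff l g"
      using sums_single[of j0 "\<lambda>_. fcoeff l g"] by (rule sums_unique[symmetric])
    finally show ?thesis .
  qed
  have "AE x in torus. g x - S x = 0"
    by (rule fcoeff_unique) (simp_all add: g int_S fcoeff_diff fcoeff_S)
  then show ?thesis
  proof eventually_elim
    case (elim x)
    then have "cmod (g x) = norm (\<Sum>j. s j x)" by (simp add: S_def)
    also have "\<dots> \<le> (\<Sum>j. norm (s j x))" by (rule summable_norm[OF summable_s])
    finally show ?case by (simp add: norm_s suminf_b)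
  qed
qed

section \<open>Splitting the coordinates into \<open>u\<close> and its complement\<close>

lemma Pproj_merge: "Pproj u f x = (LINT y|PiM (- u) (\<lambda>_. T1). f (merge u (- u) (x, y)))"
  unfolding Pproj_def merge_def by (simp cong: if_cong)

lemma character_cong: "(\<And>i. i \<in> J \<Longrightarrow> x i = y i) \<Longrightarrow> character J k x = character J k y"
  unfolding character_def by simp

lemma character_merge:
  fixes u :: "'n::finite set"
  shows "character UNIV k (merge u (- u) (x, y)) = character u k x * character (- u) k y"
proof -
  have "character UNIV k z = character u k z * character (- u) k z" for z
    unfolding character_def by (subst prod.union_disjoint[symmetric]) auto
  moreover have "character u k (merge u (- u) (x, y)) = character u k x" "character (- u) k (merge u (- u) (x, y)) = character (- u) k y"
    by (auto intro!: character_cong)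
  ultimately show ?thesis by simp
qed

section \<open>Fourier coefficients of the ANOVA terms\<close>

lemma Pproj_cong: "(\<And>i. i \<in> u \<Longrightarrow> x i = y i) \<Longrightarrow> Pproj u f x = Pproj u f y"
  unfolding Pproj_def by (simp cong: if_cong)

text \<open>Fubini gives integrability over the coordinates in \<open>u\<close>. Since
  \<open>Pproj u f\<close> depends on these alone, it is pulled back to the torus along the
  measure-preserving restriction.\<close>

lemma integrable_Pproj:
  fixes f :: "('n::finite \<Rightarrow> real) \<Rightarrow> complex"
  assumes f: "integrable torus f"
  shows "integrable torus (Pproj u f)"
proof -
  interpret U: prob_space "PiM u (\<lambda>_. T1)" by (intro prob_space_PiM prob_space_T1)
  interpret V: prob_space "PiM (- u) (\<lambda>_. T1)" by (intro prob_space_PiM prob_space_T1)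
  interpret P: pair_prob_space "PiM u (\<lambda>_. T1)" "PiM (- u) (\<lambda>_. T1)" ..
  have merge: "distr (PiM u (\<lambda>_. T1) \<Otimes>\<^sub>M PiM (- u) (\<lambda>_. T1)) torus (merge u (- u)) = torus"
    using product_sigma_finite.distr_merge[OF product_sigma_finite_T1, of u "- u"]
    by (simp add: torus_def)
  have "merge u (- u) \<in> PiM u (\<lambda>_. T1) \<Otimes>\<^sub>M PiM (- u) (\<lambda>_. T1) \<rightarrow>\<^sub>M torus"
    using measurable_merge[of u "- u" "\<lambda>_. T1"] by (simp add: torus_def)
  from integrable_distr[OF this, of f]
  have "integrable (PiM u (\<lambda>_. T1) \<Otimes>\<^sub>M PiM (- u) (\<lambda>_. T1)) (\<lambda>z. f (merge u (- u) z))"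
    using f unfolding merge by simp
  then have "integrable (PiM u (\<lambda>_. T1)) (\<lambda>x. LINT y|PiM (- u) (\<lambda>_. T1). f (merge u (- u) (x, y)))"
    by (rule P.integrable_fst')
  then have int: "integrable (PiM u (\<lambda>_. T1)) (Pproj u f)"
    unfolding Pproj_merge[abs_def] .
  have "product_prob_space (\<lambda>_. T1)"
    unfolding product_prob_space_def product_prob_space_axioms_def
    using product_sigma_finite_T1 prob_space_T1 by simp
  from product_prob_space.distr_PiM_restrict_finite[OF this, of u UNIV]
  have restrict: "distr torus (PiM u (\<lambda>_. T1)) (\<lambda>x. restrict x u) = PiM u (\<lambda>_. T1)"
    by (simp add: torus_def)
  have "(\<lambda>x. restrict x u) \<in> torus \<rightarrow>\<^sub>M PiM u (\<lambda>_. T1)"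
    unfolding torus_def by (rule measurable_restrict_subset) simp
  from integrable_distr[OF this, of "Pproj u f"]
  have "integrable torus (\<lambda>x. Pproj u f (restrict x u))"
    using int unfolding restrict by simp
  moreover have "Pproj u f (restrict x u) = Pproj u f x" for x
    by (rule Pproj_cong) simp
  ultimately show ?thesis by simp
qed

text \<open>Fubini, with the character split so that its \<open>u\<close>-part leaves the inner
  integral.\<close>

lemma fcoeff_fold:
  assumes "integrable torus g"
  shows "fcoeff k g = (LINT x|PiM u (\<lambda>_. T1). (LINT y|PiM (- u) (\<lambda>_. T1).
    g (merge u (- u) (x, y)) * character (- u) k y) * character u k x)"
proof -
  have "fcoeff k g = (LINT x|PiM u (\<lambda>_. T1). LINT y|PiM (- u) (\<lambda>_. T1).
      g (merge u (- u) (x, y)) * character UNIV k (merge u (- u) (x, y)))"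
    using product_sigma_finite.product_integral_fold[OF product_sigma_finite_T1, of u "- u"]
      integrable_character[OF assms, of k]
    by (simp add: fcoeff_character torus_def)
  also have "\<dots> = (LINT x|PiM u (\<lambda>_. T1). LINT y|PiM (- u) (\<lambda>_. T1).
      (g (merge u (- u) (x, y)) * character (- u) k y) * character u k x)"
    by (simp add: character_merge mult_ac)
  finally show ?thesis by simp
qed

text \<open>The projection is constant in the coordinates outside \<open>u\<close>, so the inner
  integral is that of a character: 1 if \<open>k\<close> vanishes there, else 0. In the first case
  the inner integral for \<open>f\<close> itself is \<open>Pproj u f\<close>.\<close>

lemma fcoeff_Pproj:
  assumes f: "integrable torus f"
  shows "fcoeff k (Pproj u f) = (if {i. k i \<noteq> 0} \<subseteq> u then fcoeff k f else 0)"
proof -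
  have "Pproj u f (merge u (- u) (x, y)) = Pproj u f x" for x y
    by (rule Pproj_cong) simp
  then have *: "fcoeff k (Pproj u f) = (LINT x|PiM u (\<lambda>_. T1).
      (Pproj u f x * (LINT y|PiM (- u) (\<lambda>_. T1). character (- u) k y)) * character u k x)"
    by (subst fcoeff_fold[OF integrable_Pproj[OF f], of _ _ u]) simp
  have int: "(LINT y|PiM (- u) (\<lambda>_. T1). character (- u) k y) = (if {i. k i \<noteq> 0} \<subseteq> u then 1 else 0)"
    by (subst integral_character) auto
  show ?thesis
  proof (cases "{i. k i \<noteq> 0} \<subseteq> u")
    case True
    then have "k i = 0" if "i \<in> - u" for i using that by blast
    then have "character (- u) k y = 1" for y
      by (simp add: character_def)
    then have "fcoeff k f = (LINT x|PiM u (\<lambda>_. T1). Pproj u f x * character u k x)"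
      by (simp add: fcoeff_fold[OF f, of k u] Pproj_merge)
    then show ?thesis
      using True by (simp add: * int)
  qed (simp add: * int)
qed

declare anova.simps [simp del]

lemma anova_eq: "anova f u = (\<lambda>x. Pproj u f x - (\<Sum>v\<in>{v. v \<subset> u}. anova f v x))"
  by (rule ext) (rule anova.simps)

lemma integrable_anova:
  assumes "integrable torus f"
  shows "integrable torus (anova f u)"
  using finite[of u]
proof (induction u rule: finite_psubset_induct)
  case (psubset u)
  then show ?case
    unfolding anova_eq[of f u] using integrable_Pproj[OF assms]
    by (intro Bochner_Integration.integrable_diff Bochner_Integration.integrable_sum) auto
qed

text \<open>Induction over proper subsets: the projection keeps supports contained in
  \<open>u\<close>, and the subtracted terms account for exactly the supports strictly inside
  \<open>u\<close>.\<close>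

lemma fcoeff_anova:
  assumes f: "integrable torus f"
  shows "fcoeff k (anova f u) = (if {i. k i \<noteq> 0} = u then fcoeff k f else 0)"
  using finite[of u]
proof (induction u rule: finite_psubset_induct)
  case (psubset u)
  have "fcoeff k (anova f u) = fcoeff k (Pproj u f) - (\<Sum>v\<in>{v. v \<subset> u}. fcoeff k (anova f v))"
    unfolding anova_eq[of f u]
    by (simp add: fcoeff_diff fcoeff_sum integrable_Pproj integrable_anova f)
  also have "(\<Sum>v\<in>{v. v \<subset> u}. fcoeff k (anova f v)) =
      (\<Sum>v\<in>{v. v \<subset> u}. if {i. k i \<noteq> 0} = v then fcoeff k f else 0)"
    by (intro sum.cong refl psubset.IH) simp
  also have "\<dots> = (if {i. k i \<noteq> 0} \<subset> u then fcoeff k f else 0)"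
    by simp
  finally show ?case
    by (auto simp: fcoeff_Pproj[OF f])
qed

section \<open>The truncation error\<close>

lemma integrable_TU: "integrable torus f \<Longrightarrow> integrable torus (TU U f)"
  unfolding TU_def[abs_def] by (intro Bochner_Integration.integrable_sum integrable_anova)

lemma mem_Fcompl: "k \<in> Fcompl U \<longleftrightarrow> {i. k i \<noteq> 0} \<notin> U"
proof -
  have "k \<in> Freq u \<longleftrightarrow> {i. k i \<noteq> 0} = u" for u
    by (auto simp: Freq_def)
  then show ?thesis by (simp add: Fcompl_def)
qed

lemma fcoeff_diff_TU:
  assumes f: "integrable torus f"
  shows "fcoeff k (\<lambda>x. f x - TU U f x) = (if k \<in> Fcompl U then fcoeff k f else 0)"
proof -
  have "fcoeff k (TU U f) = (\<Sum>u\<in>U. if {i. k i \<noteq> 0} = u then fcoeff k f else 0)"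
    unfolding TU_def[abs_def] by (simp add: fcoeff_sum fcoeff_anova integrable_anova f)
  \<comment> \<open>At most one summand is nonzero: the one at the support of \<open>k\<close>,
    present when that support is in \<open>U\<close>.\<close>
  also have "\<dots> = (if k \<in> Fcompl U then 0 else fcoeff k f)"
    by (simp add: mem_Fcompl)
  finally show ?thesis
    by (simp add: fcoeff_diff f integrable_TU)
qed

text \<open>The series bound is applied to the error itself, so summability is asked only of the
  frequencies that survive. Both estimates reduce to bounding this sum.\<close>

lemma Linf_norm_diff_TU_le:
  assumes f: "integrable torus f" and sum: "(\<lambda>k. cmod (fcoeff k f)) summable_on Fcompl U"
  shows "Linf_norm (\<lambda>x. f x - TU U f x) \<le> ennreal (\<Sum>\<^sub>\<infinity>k\<in>Fcompl U. cmod (fcoeff k f))"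
proof -
  let ?h = "\<lambda>x. f x - TU U f x"
  have h: "integrable torus ?h" using f by (intro Bochner_Integration.integrable_diff integrable_TU)
  have "(\<lambda>k. cmod (fcoeff k ?h)) summable_on UNIV"
    using sum by (rule summable_on_cong_neutral[THEN iffD1, rotated 3]) (simp_all add: fcoeff_diff_TU[OF f])
  moreover have "(\<Sum>\<^sub>\<infinity>k. cmod (fcoeff k ?h)) = (\<Sum>\<^sub>\<infinity>k\<in>Fcompl U. cmod (fcoeff k f))"
    by (rule infsum_cong_neutral) (simp_all add: fcoeff_diff_TU[OF f])
  ultimately have "AE x in torus. cmod (?h x) \<le> (\<Sum>\<^sub>\<infinity>k\<in>Fcompl U. cmod (fcoeff k f))"
    using AE_norm_le_infsum_fcoeff[OF h] by simp
  then have "AE x in torus. ennreal (cmod (?h x)) \<le> ennreal (\<Sum>\<^sub>\<infinity>k\<in>Fcompl U. cmod (fcoeff k f))"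
    by eventually_elim (rule ennreal_leI)
  moreover have "(\<lambda>x. ennreal (cmod (?h x))) \<in> borel_measurable torus"
    using borel_measurable_integrable[OF h] by measurable
  ultimately show ?thesis
    unfolding Linf_norm_def by (intro esssup_I)
qed

section \<open>Square-integrable functions and square-summable families\<close>

lemma L2_subset_L1: "L2 \<subseteq> L1"
proof
  fix f :: "('n::finite \<Rightarrow> real) \<Rightarrow> complex" assume "f \<in> L2"
  then have f: "f \<in> borel_measurable torus" "integrable torus (\<lambda>x. (cmod (f x))\<^sup>2)"
    by (simp_all add: L2_def)
  interpret prob_space "torus :: ('n \<Rightarrow> real) measure" by (rule prob_space_torus)
  \<comment> \<open>With total mass 1 the constant is integrable, so
    \<open>1 + (cmod (f x))\<^sup>2\<close> is an integrable majorant.\<close>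
  have "t \<le> 1 + t\<^sup>2" for t :: real
    using zero_le_power2[of "t - 1/2"] by (simp add: power2_eq_square field_simps)
  then have "integrable torus f"
    using f by (intro Bochner_Integration.integrable_bound[of _ "\<lambda>x. 1 + (cmod (f x))\<^sup>2" f]) auto
  then show "f \<in> L1" by (simp add: L1_def)
qed

text \<open>The finite inequality bounds all partial sums uniformly; for nonnegative terms this
  gives summability and the bound at once.\<close>

lemma Cauchy_Schwarz_infsum:
  fixes a b :: "'a \<Rightarrow> real"
  assumes a: "(\<lambda>k. (a k)\<^sup>2) summable_on A" and b: "(\<lambda>k. (b k)\<^sup>2) summable_on A"
    and nonneg: "\<And>k. k \<in> A \<Longrightarrow> 0 \<le> a k * b k"
  shows "(\<lambda>k. a k * b k) summable_on A"
    and "(\<Sum>\<^sub>\<infinity>k\<in>A. a k * b k) \<le> sqrt (\<Sum>\<^sub>\<infinity>k\<in>A. (a k)\<^sup>2) * sqrt (\<Sum>\<^sub>\<infinity>k\<in>A. (b k)\<^sup>2)"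
proof -
  have le: "(\<Sum>k\<in>F. a k * b k) \<le> sqrt (\<Sum>\<^sub>\<infinity>k\<in>A. (a k)\<^sup>2) * sqrt (\<Sum>\<^sub>\<infinity>k\<in>A. (b k)\<^sup>2)"
    if F: "finite F" "F \<subseteq> A" for F
  proof -
    have "(\<Sum>k\<in>F. a k * b k)\<^sup>2 \<le> (\<Sum>k\<in>F. (a k)\<^sup>2) * (\<Sum>k\<in>F. (b k)\<^sup>2)"
      by (rule Cauchy_Schwarz_ineq_sum)
    also have "\<dots> \<le> (\<Sum>\<^sub>\<infinity>k\<in>A. (a k)\<^sup>2) * (\<Sum>\<^sub>\<infinity>k\<in>A. (b k)\<^sup>2)"
      using F a b by (intro mult_mono finite_sum_le_infsum infsum_nonneg sum_nonneg) auto
    finally show ?thesis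
      unfolding real_sqrt_mult[symmetric] by (rule real_le_rsqrt)
  qed
  show sum: "(\<lambda>k. a k * b k) summable_on A"
    using le by (intro nonneg_bdd_above_summable_on nonneg bdd_aboveI2) auto
  show "(\<Sum>\<^sub>\<infinity>k\<in>A. a k * b k) \<le> sqrt (\<Sum>\<^sub>\<infinity>k\<in>A. (a k)\<^sup>2) * sqrt (\<Sum>\<^sub>\<infinity>k\<in>A. (b k)\<^sup>2)"
    using sum le by (rule infsum_le_finite_sums)
qed

text \<open>The quotient is multiplied out, which covers norm 0. The reciprocal of the minimum
  becomes a supremum of \<open>1 / w k\<close>, so the minimum need not be attained, and an empty
  \<open>Fcompl U\<close> gives factor 0.\<close>

theorem theorem4p7:
  fixes U :: "'n::finite set set"
    and w :: "('n \<Rightarrow> int) \<Rightarrow> real"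
  assumes U: "anova_subset U"
    and w: "\<forall>k. w k \<ge> 1"
  shows "(\<forall>f \<in> Aw w.
            Linf_norm (\<lambda>x. f x - TU U f x)
              \<le> ennreal (Aw_norm w f) * (SUP k\<in>Fcompl U. ennreal (1 / w k)))
       \<and> ((\<lambda>k. (1 / w k)\<^sup>2) summable_on UNIV \<longrightarrow>
          (\<forall>f \<in> Hw w.
            Linf_norm (\<lambda>x. f x - TU U f x)
              \<le> ennreal (sqrt (\<Sum>\<^sub>\<infinity>k\<in>Fcompl U. 1 / (w k)\<^sup>2) * Hw_norm w f)))"
proof (intro conjI ballI impI)
  have w_pos: "w k > 0" for k using w[rule_format, of k] by linarith
  {
    fix f assume "f \<in> Aw w"
    then have f: "integrable torus f" and sum: "(\<lambda>k. w k * cmod (fcoeff k f)) summable_on UNIV"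
      by (simp_all add: Aw_def L1_def)
    \<comment> \<open>As the weights are at least 1, the supremum is finite and can be replaced by a
      real \<open>r\<close>.\<close>
    have "(SUP k\<in>Fcompl U. ennreal (1 / w k)) \<le> ennreal 1"
      using w w_pos by (intro SUP_least ennreal_leI) simp
    then obtain r where r: "0 \<le> r" "(SUP k\<in>Fcompl U. ennreal (1 / w k)) = ennreal r"
      by (metis ennreal_cases ennreal_one_neq_top ennreal_1 top_unique)
    have coeff_le: "cmod (fcoeff k f) \<le> r * (w k * cmod (fcoeff k f))" if "k \<in> Fcompl U" for k
    proof -
      have "ennreal (1 / w k) \<le> ennreal r"
        unfolding r(2)[symmetric] using that by (rule SUP_upper)
      then have "1 \<le> r * w k"
        using w_pos[of k] r(1) by (simp add: ennreal_le_iff field_simps)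
      from mult_right_mono[OF this, of "cmod (fcoeff k f)"] show ?thesis
        by (simp add: mult.assoc)
    qed
    have sum_r: "(\<lambda>k. r * (w k * cmod (fcoeff k f))) summable_on UNIV"
      using sum by (rule summable_on_cmult_right)
    then have sum_rF: "(\<lambda>k. r * (w k * cmod (fcoeff k f))) summable_on Fcompl U"
      by (rule summable_on_subset_banach) simp
    have sum_c: "(\<lambda>k. cmod (fcoeff k f)) summable_on Fcompl U"
      using sum_rF by (rule summable_on_comparison_test) (use coeff_le in auto)
    have "(\<Sum>\<^sub>\<infinity>k\<in>Fcompl U. cmod (fcoeff k f)) \<le> (\<Sum>\<^sub>\<infinity>k\<in>Fcompl U. r * (w k * cmod (fcoeff k f)))"
      using sum_c sum_rF coeff_le by (rule infsum_mono)
    also have "\<dots> \<le> (\<Sum>\<^sub>\<infinity>k. r * (w k * cmod (fcoeff k f)))"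
      using sum_rF sum_r w_pos r(1) by (intro infsum_mono2) (auto simp: less_imp_le)
    also have "\<dots> = Aw_norm w f * r"
      by (simp add: Aw_norm_def infsum_cmult_right')
    finally have "ennreal (\<Sum>\<^sub>\<infinity>k\<in>Fcompl U. cmod (fcoeff k f)) \<le> ennreal (Aw_norm w f * r)"
      by (rule ennreal_leI)
    also have "\<dots> = ennreal (Aw_norm w f) * (SUP k\<in>Fcompl U. ennreal (1 / w k))"
      using r(1) w_pos by (simp add: r(2) Aw_norm_def ennreal_mult infsum_nonneg less_imp_le)
    finally show "Linf_norm (\<lambda>x. f x - TU U f x)
        \<le> ennreal (Aw_norm w f) * (SUP k\<in>Fcompl U. ennreal (1 / w k))"
      using Linf_norm_diff_TU_le[OF f sum_c] by (rule order_trans[rotated])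
  next
    fix f assume "f \<in> Hw w"
    then have "f \<in> L2" and sum: "(\<lambda>k. (w k * cmod (fcoeff k f))\<^sup>2) summable_on UNIV"
      by (simp_all add: Hw_def power_mult_distrib)
    then have f: "integrable torus f" using L2_subset_L1 by (auto simp: L1_def)
    assume "(\<lambda>k. (1 / w k)\<^sup>2) summable_on UNIV"
    then have sum_w: "(\<lambda>k. (1 / w k)\<^sup>2) summable_on Fcompl U"
      by (rule summable_on_subset_banach) simp
    have sum_F: "(\<lambda>k. (w k * cmod (fcoeff k f))\<^sup>2) summable_on Fcompl U"
      using sum by (rule summable_on_subset_banach) simp
    \<comment> \<open>The splitting to which Cauchy-Schwarz is applied.\<close>
    have eq: "1 / w k * (w k * cmod (fcoeff k f)) = cmod (fcoeff k f)" for k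
      using w_pos[of k] by simp
    have sum_c: "(\<lambda>k. cmod (fcoeff k f)) summable_on Fcompl U"
      using Cauchy_Schwarz_infsum(1)[OF sum_w sum_F] unfolding eq by simp
    have "(\<Sum>\<^sub>\<infinity>k\<in>Fcompl U. cmod (fcoeff k f)) \<le>
        sqrt (\<Sum>\<^sub>\<infinity>k\<in>Fcompl U. (1 / w k)\<^sup>2) * sqrt (\<Sum>\<^sub>\<infinity>k\<in>Fcompl U. (w k * cmod (fcoeff k f))\<^sup>2)"
      using Cauchy_Schwarz_infsum(2)[OF sum_w sum_F] unfolding eq by simp
    also have "\<dots> \<le> sqrt (\<Sum>\<^sub>\<infinity>k\<in>Fcompl U. (1 / w k)\<^sup>2) * sqrt (\<Sum>\<^sub>\<infinity>k. (w k * cmod (fcoeff k f))\<^sup>2)"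
      using sum_F sum by (intro mult_left_mono real_sqrt_le_mono infsum_mono2) (simp_all add: infsum_nonneg)
    also have "\<dots> = sqrt (\<Sum>\<^sub>\<infinity>k\<in>Fcompl U. 1 / (w k)\<^sup>2) * Hw_norm w f"
      by (simp add: Hw_norm_def power_mult_distrib power_divide)
    finally show "Linf_norm (\<lambda>x. f x - TU U f x)
        \<le> ennreal (sqrt (\<Sum>\<^sub>\<infinity>k\<in>Fcompl U. 1 / (w k)\<^sup>2) * Hw_norm w f)"
      using Linf_norm_diff_TU_le[OF f sum_c] by (meson ennreal_leI order_trans)
  }
qed

end
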